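(* Let $d\ge2$, $m\ge1$, $\omega\in\Omega_{d,m}$, let $G=G_\omega$ be the corresponding spinal group with spinal generating set $S$, and let $\xi\in X^{\mathbb{N}}$. Then the Schreier graph $\Gamma_\xi$ of the action of $G$ on the orbit $G\cdot\xi$ with respect to $S$ has vertex set $\operatorname{Cof}(\xi)$ and the following outgoing edges at every $\eta=\eta_0\eta_1\dots\in\operatorname{Cof}(\xi)$: (1) for every $j\in X\setminus\{0\}$, an edge labeled $a^j$ to $(\eta_0+j)\eta_1\eta_2\dots$; (2) for every $b\in B\setminus\{1\}$: if $\eta=(d-1)^n0\,\eta_{n+1}\sigma^{n+2}(\eta)$ for some $n\ge0$, an edge labeled $b$ to $(d-1)^n0(\eta_{n+1}+j)\sigma^{n+2}(\eta)$, where $j$ is such that $\omega_n(b)=a^j$; otherwise, a loop at $\eta$ labeled $b$.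
   Context: Let $X=\{0,\dots,d-1\}$ with addition modulo $d$. $T_d$ is the $d$-ary rooted tree with vertex set $X^*$; its boundary is $X^{\mathbb{N}}$ (infinite words), and automorphisms of $T_d$ act on $X^{\mathbb{N}}$ via their action on prefixes. Let $a(v_0v_1\dots)=(v_0+1)v_1\dots$ and $A=\langle a\rangle\cong\mathbb{Z}/d\mathbb{Z}$. Let $B=(\mathbb{Z}/d\mathbb{Z})^m$ and let $\operatorname{Epi}(B,A)$ be the set of surjective homomorphisms $B\to A$. $\Omega_{d,m}$ is the set of sequences $\omega=(\omega_n)_{n\ge0}$ in $\operatorname{Epi}(B,A)$ with $\bigcap_{j\ge i}\operatorname{Ker}(\omega_j)=1$ for all $i\ge0$. For $b\in B$, $b_\omega\in\operatorname{Aut}(T_d)$ sends a word of the form $(d-1)^r0v_{r+1}v_{r+2}\dots$ ($r\ge0$) to $(d-1)^r0\,\omega_r(b)(v_{r+1})\,v_{r+2}\dots$ and fixes all other words. The map $b\mapsto b_\omega$ is an injective homomorphism, and $B$ is identified with its image $B_\omega$. The spinal group is $G_\omega=\langle A,B_\omega\rangle$ and its spinal generating set is $S=(A\cup B_\omega)\setminus\{1\}$. The Schreier graph $\Gamma_\xi$ has as vertex set the orbit $G\cdot\xi$ and a directed edge labeled $s$ from $y$ to $s(y)$ for all $y\in G\cdot\xi$, $s\in S$. The shift $\sigma:X^{\mathbb{N}}\to X^{\mathbb{N}}$ deletes the first letter. $\operatorname{Cof}(\xi)$ is the set of $\eta\in X^{\mathbb{N}}$ cofinal with $\xi$, i.e.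 such that $\sigma^r(\xi)=\sigma^r(\eta)$ for some $r\ge0$. *)

theory Defs
  imports "HOL-Algebra.Product_Groups" "HOL-Algebra.Group_Action"
   "HOL-Library.Stream" "Graph_Theory.Digraph"
begin

section \<open>The rooted tree, its automorphisms and its boundary\<close>

definition words :: "nat \<Rightarrow> nat list set" where
  "words d = lists {..<d}"

definition tree_adj :: "nat list \<Rightarrow> nat list \<Rightarrow> bool" where
  "tree_adj u v \<longleftrightarrow> (\<exists>x. v = u @ [x]) \<or> (\<exists>x. u = v @ [x])"

text \<open>Following \<^const>\<open>BijGroup\<close>, automorphisms are extensional outside
  the vertex set, and the product of \<open>g\<close> and \<open>f\<close> is "first \<open>f\<close>, then \<open>g\<close>".\<close>

definition tree_aut :: "nat \<Rightarrow> (nat list \<Rightarrow> nat list) monoid" where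
  "tree_aut d = BijGroup (words d)
     \<lparr>carrier := {f \<in> Bij (words d). f [] = [] \<and>
        (\<forall>u\<in>words d. \<forall>v\<in>words d. tree_adj (f u) (f v) \<longleftrightarrow> tree_adj u v)}\<rparr>"

definition boundary :: "nat \<Rightarrow> nat stream set" where
  "boundary d = streams {..<d}"

text \<open>For a tree automorphism \<open>f\<close>, letter \<open>n\<close> of \<open>boundary_act f \<xi>\<close> is the last
  letter of the image of the prefix of \<open>\<xi>\<close> of length \<open>n + 1\<close>.\<close>

definition boundary_act :: "(nat list \<Rightarrow> nat list) \<Rightarrow> nat stream \<Rightarrow> nat stream" where
  "boundary_act f \<xi> = smap (\<lambda>n. f (stake (Suc n) \<xi>) ! n) nats"

definition Cof :: "nat \<Rightarrow> nat stream \<Rightarrow> nat stream set" where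
  "Cof d \<xi> = {\<eta> \<in> boundary d. \<exists>r. sdrop r \<xi> = sdrop r \<eta>}"

section \<open>Spinal groups\<close>

definition rot :: "nat \<Rightarrow> nat list \<Rightarrow> nat list" where
  "rot d = (\<lambda>w\<in>words d. case w of [] \<Rightarrow> [] | v # u \<Rightarrow> ((v + 1) mod d) # u)"

definition A_grp :: "nat \<Rightarrow> (nat list \<Rightarrow> nat list) monoid" where
  "A_grp d = subgroup_generated (tree_aut d) {rot d}"

definition B_grp :: "nat \<Rightarrow> nat \<Rightarrow> (nat \<Rightarrow> int) monoid" where
  "B_grp d m = product_group {..<m} (\<lambda>_. integer_mod_group d)"

definition Omega ::
  "nat \<Rightarrow> nat \<Rightarrow> (nat \<Rightarrow> (nat \<Rightarrow> int) \<Rightarrow> (nat list \<Rightarrow> nat list)) set" where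
  "Omega d m = {\<omega>. (\<forall>n. \<omega> n \<in> epi (B_grp d m) (A_grp d)) \<and>
     (\<forall>i. (\<Inter>j\<in>{i..}. kernel (B_grp d m) (A_grp d) (\<omega> j)) = {\<one>\<^bsub>B_grp d m\<^esub>})}"

text \<open>The automorphism \<open>b\<^sub>\<omega>\<close>. An element \<open>g\<close> of \<open>A\<close> acts on a single letter \<open>v\<close>
  through its action on the first level of the tree, that is, by \<open>v \<mapsto> hd (g [v])\<close>.
  For \<open>d \<ge> 2\<close> the decomposition of \<open>w\<close> is unique if it exists, so the description is proper.\<close>

definition b_aut ::
  "nat \<Rightarrow> (nat \<Rightarrow> (nat \<Rightarrow> int) \<Rightarrow> (nat list \<Rightarrow> nat list)) \<Rightarrow> (nat \<Rightarrow> int) \<Rightarrow> nat list \<Rightarrow> nat list" where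
  "b_aut d \<omega> b = (\<lambda>w\<in>words d.
     if \<exists>r v u. w = replicate r (d - 1) @ 0 # v # u
     then THE w'. \<exists>r v u. w = replicate r (d - 1) @ 0 # v # u \<and>
                          w' = replicate r (d - 1) @ 0 # hd (\<omega> r b [v]) # u
     else w)"

definition B_img ::
  "nat \<Rightarrow> nat \<Rightarrow> (nat \<Rightarrow> (nat \<Rightarrow> int) \<Rightarrow> (nat list \<Rightarrow> nat list)) \<Rightarrow> (nat list \<Rightarrow> nat list) set" where
  "B_img d m \<omega> = b_aut d \<omega> ` carrier (B_grp d m)"

definition spinal_group ::
  "nat \<Rightarrow> nat \<Rightarrow> (nat \<Rightarrow> (nat \<Rightarrow> int) \<Rightarrow> (nat list \<Rightarrow> nat list)) \<Rightarrow> (nat list \<Rightarrow> nat list) monoid" where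
  "spinal_group d m \<omega> = subgroup_generated (tree_aut d) (carrier (A_grp d) \<union> B_img d m \<omega>)"

definition spinal_gens ::
  "nat \<Rightarrow> nat \<Rightarrow> (nat \<Rightarrow> (nat \<Rightarrow> int) \<Rightarrow> (nat list \<Rightarrow> nat list)) \<Rightarrow> (nat list \<Rightarrow> nat list) set" where
  "spinal_gens d m \<omega> = (carrier (A_grp d) \<union> B_img d m \<omega>) - {\<one>\<^bsub>tree_aut d\<^esub>}"

section \<open>Schreier graphs\<close>

text \<open>An arc is a triple (source, label, target), so that parallel arcs with different
  labels are kept apart.\<close>

definition schreier_graph ::
  "('g, 'c) monoid_scheme \<Rightarrow> 'g set \<Rightarrow> ('g \<Rightarrow> 'v \<Rightarrow> 'v) \<Rightarrow> 'v \<Rightarrow> ('v, 'v \<times> 'g \<times> 'v) pre_digraph" where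
  "schreier_graph G S \<phi> x =
     \<lparr>verts = orbit G \<phi> x,
      arcs = {(y, s, \<phi> s y) | y s. y \<in> orbit G \<phi> x \<and> s \<in> S},
      tail = (\<lambda>(y, s, z). y),
      head = (\<lambda>(y, s, z). z)\<rparr>"

definition spinal_schreier ::
  "nat \<Rightarrow> nat \<Rightarrow> (nat \<Rightarrow> (nat \<Rightarrow> int) \<Rightarrow> (nat list \<Rightarrow> nat list)) \<Rightarrow> nat stream
     \<Rightarrow> (nat stream, nat stream \<times> (nat list \<Rightarrow> nat list) \<times> nat stream) pre_digraph" where
  "spinal_schreier d m \<omega> \<xi> =
     schreier_graph (spinal_group d m \<omega>) (spinal_gens d m \<omega>) boundary_act \<xi>"

end

theory Submission
  imports Defs "HOL-Number_Theory.Cong"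
begin

text \<open>Powers of \<open>a\<close> and the elements \<open>b\<^sub>\<omega>\<close> add to each letter, modulo \<open>d\<close>, a number depending only
  on the prefix before it. Every such rule is a tree automorphism, and its action on infinite words
  can be read off directly, which gives the arcs. Each generator changes at most one letter, so
  orbits stay inside cofinality classes. Since every \<open>\<omega> n\<close> is onto, any finite prefix can be
  changed into any other one of the same length while the rest of the word is kept, so orbits
  exhaust cofinality classes. The kernel condition enters only in that \<open>b \<noteq> 1\<close> implies
  \<open>b\<^sub>\<omega> \<noteq> 1\<close>.\<close>

section \<open>Tree automorphisms and their action on infinite words\<close>

lemma words_take: "w \<in> words d \<Longrightarrow> take n w \<in> words d"
  unfolding words_def by (meson in_listsD in_listsI set_take_subset subsetD)

lemma stake_words: "\<eta> \<in> boundary d \<Longrightarrow> stake n \<eta> \<in> words d"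
  by (auto simp: words_def boundary_def in_set_conv_nth streams_iff_snth)

lemma tree_aut_carrier_iff:
  "f \<in> carrier (tree_aut d) \<longleftrightarrow> f \<in> Bij (words d) \<and> f [] = [] \<and>
     (\<forall>u\<in>words d. \<forall>v\<in>words d. tree_adj (f u) (f v) \<longleftrightarrow> tree_adj u v)"
  by (simp add: tree_aut_def)

lemma one_tree_aut: "\<one>\<^bsub>tree_aut d\<^esub> = (\<lambda>w\<in>words d. w)"
  by (simp add: tree_aut_def BijGroup_def)

lemma mult_tree_aut:
  "g \<in> carrier (tree_aut d) \<Longrightarrow> f \<in> carrier (tree_aut d) \<Longrightarrow>
     g \<otimes>\<^bsub>tree_aut d\<^esub> f = compose (words d) g f"
  by (simp add: tree_aut_def BijGroup_def)

text \<open>The automorphisms form a subgroup of the group of bijections of the vertex set. Closure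
  under inverses works because the adjacency condition is an equivalence: it can be read at the
  preimages of \<open>u\<close> and \<open>v\<close>.\<close>

lemma group_tree_aut: "group (tree_aut d)"
proof -
  let ?G = "BijGroup (words d)"
  interpret B: group ?G by (rule group_BijGroup)
  have car: "carrier ?G = Bij (words d)" by (simp add: BijGroup_def)
  have Nil: "[] \<in> words d" by (simp add: words_def)
  have "subgroup (carrier (tree_aut d)) ?G"
  proof (rule B.subgroupI)
    show "carrier (tree_aut d) \<subseteq> carrier ?G"
      by (auto simp: tree_aut_carrier_iff car)
    have "(\<lambda>w\<in>words d. w) \<in> carrier (tree_aut d)"
      using Nil by (simp add: tree_aut_carrier_iff id_Bij)
    then show "carrier (tree_aut d) \<noteq> {}" by blast
  next
    fix f assume f: "f \<in> carrier (tree_aut d)"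
    then have fB: "f \<in> Bij (words d)" and f0: "f [] = []"
      and adj: "\<And>u v. u \<in> words d \<Longrightarrow> v \<in> words d \<Longrightarrow> tree_adj (f u) (f v) \<longleftrightarrow> tree_adj u v"
      by (auto simp: tree_aut_carrier_iff)
    have bij: "bij_betw f (words d) (words d)" using fB by (simp add: Bij_def)
    have inv: "inv\<^bsub>?G\<^esub> f = (\<lambda>w\<in>words d. inv_into (words d) f w)"
      by (rule inv_BijGroup[OF fB])
    have finv: "f (inv_into (words d) f w) = w" if "w \<in> words d" for w
      using bij that by (simp add: bij_betw_inv_into_right)
    have mem: "inv_into (words d) f w \<in> words d" if "w \<in> words d" for w
      using Bij_inv_into_mem[OF fB that] .
    have "inv_into (words d) f [] = []"
      using bij f0 Nil by (metis bij_betw_inv_into_left)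
    moreover have "tree_adj (inv_into (words d) f u) (inv_into (words d) f v) \<longleftrightarrow> tree_adj u v"
      if "u \<in> words d" "v \<in> words d" for u v
      using adj[OF mem mem, OF that] finv that by simp
    ultimately show "inv\<^bsub>?G\<^esub> f \<in> carrier (tree_aut d)"
      using restrict_inv_into_Bij[OF fB] Nil by (simp add: tree_aut_carrier_iff inv)
  next
    fix f g assume f: "f \<in> carrier (tree_aut d)" and g: "g \<in> carrier (tree_aut d)"
    then have B: "f \<in> Bij (words d)" "g \<in> Bij (words d)" by (auto simp: tree_aut_carrier_iff)
    have gw: "g w \<in> words d" if "w \<in> words d" for w
      using Bij_imp_funcset[OF B(2)] that by auto
    have "compose (words d) f g \<in> carrier (tree_aut d)"
      using f g compose_Bij[OF B] Nil gw by (simp add: tree_aut_carrier_iff compose_eq)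
    then show "f \<otimes>\<^bsub>?G\<^esub> g \<in> carrier (tree_aut d)"
      using B by (simp add: BijGroup_def)
  qed
  then have "group (?G\<lparr>carrier := carrier (tree_aut d)\<rparr>)"
    by (rule subgroup.subgroup_is_group) (rule B.group_axioms)
  moreover have "?G\<lparr>carrier := carrier (tree_aut d)\<rparr> = tree_aut d"
    by (simp add: tree_aut_def)
  ultimately show ?thesis by simp
qed

lemma tree_aut_closed:
  "f \<in> carrier (tree_aut d) \<Longrightarrow> w \<in> words d \<Longrightarrow> f w \<in> words d"
  using Bij_imp_funcset by (fastforce simp: tree_aut_carrier_iff)

text \<open>Adjacency is symmetric, so preserving it does not say at once that children go to
  children. The root is fixed and has no parent, and the induction carries this orientation down the
  tree.\<close>

lemma tree_aut_snoc:
  assumes f: "f \<in> carrier (tree_aut d)" and w: "w @ [x] \<in> words d"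
  shows "length (f w) = length w \<and> (\<exists>y. f (w @ [x]) = f w @ [y])"
  using w
proof (induction w arbitrary: x rule: rev_induct)
  case Nil
  have "[] \<in> words d" by (simp add: words_def)
  moreover have "tree_adj [] [x]" by (simp add: tree_adj_def)
  ultimately have "tree_adj (f []) (f [x])"
    using f Nil unfolding tree_aut_carrier_iff by (metis append_Nil)
  moreover have "f [] = []" using f by (simp add: tree_aut_carrier_iff)
  ultimately show ?case by (simp add: tree_adj_def)
next
  case (snoc z u)
  have u: "u \<in> words d" "u @ [z] \<in> words d" using snoc.prems by (auto simp: words_def)
  from snoc.IH[OF u(2)] obtain y where
    len: "length (f u) = length u" and y: "f (u @ [z]) = f u @ [y]" by blast
  have "tree_adj (u @ [z]) ((u @ [z]) @ [x])" by (simp add: tree_adj_def)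
  then have "tree_adj (f (u @ [z])) (f ((u @ [z]) @ [x]))"
    using f u snoc.prems by (simp only: tree_aut_carrier_iff)
  then consider t where "f ((u @ [z]) @ [x]) = f (u @ [z]) @ [t]"
    | t where "f (u @ [z]) = f ((u @ [z]) @ [x]) @ [t]"
    by (auto simp: tree_adj_def)
  then show ?case
  proof cases
    case 1
    then show ?thesis using len y by simp
  next
    \<comment> \<open>If the child went to the parent of \<open>f (u @ [z])\<close>, it would go to
      \<open>f u\<close>, which is already the image of \<open>u\<close>; this contradicts
      injectivity.\<close>
    case 2
    then have "f ((u @ [z]) @ [x]) = f u" using y by simp
    moreover have "inj_on f (words d)"
      using f by (simp add: tree_aut_carrier_iff Bij_def bij_betw_def)
    ultimately have "(u @ [z]) @ [x] = u" using u snoc.prems by (meson inj_onD)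
    then show ?thesis by simp
  qed
qed

lemma tree_aut_length:
  assumes f: "f \<in> carrier (tree_aut d)" and w: "w \<in> words d"
  shows "length (f w) = length w"
proof (cases w rule: rev_cases)
  case Nil
  then show ?thesis using f by (simp add: tree_aut_carrier_iff)
next
  case (snoc u x)
  then show ?thesis using tree_aut_snoc[OF f] w by fastforce
qed

text \<open>This compatibility with prefixes makes the letters chosen by \<open>boundary_act\<close>
  at different levels fit together to one infinite word.\<close>

lemma tree_aut_take:
  assumes f: "f \<in> carrier (tree_aut d)"
  shows "w \<in> words d \<Longrightarrow> take n (f w) = f (take n w)"
proof (induction w rule: rev_induct)
  case Nil
  then show ?case using f by (simp add: tree_aut_carrier_iff)
next
  case (snoc x u)
  have u: "u \<in> words d" using snoc.prems by (auto simp: words_def)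
  obtain y where y: "f (u @ [x]) = f u @ [y]" and len: "length (f u) = length u"
    using tree_aut_snoc[OF f snoc.prems] by blast
  show ?case
  proof (cases "n \<le> length u")
    case True
    then show ?thesis using snoc.IH[OF u] y len by simp
  next
    case False
    then show ?thesis using y len by simp
  qed
qed

text \<open>Letter \<open>i\<close> of the image is read off from the prefix of length
  \<open>i + 1\<close>; by \<open>tree_aut_take\<close> any longer prefix gives the same letter.
  Claims about infinite words thereby reduce to claims about finite prefixes.\<close>

lemma stake_boundary_act:
  assumes f: "f \<in> carrier (tree_aut d)" and \<eta>: "\<eta> \<in> boundary d"
  shows "stake n (boundary_act f \<eta>) = f (stake n \<eta>)"
proof (rule nth_equalityI)
  show "length (stake n (boundary_act f \<eta>)) = length (f (stake n \<eta>))"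
    using tree_aut_length[OF f stake_words[OF \<eta>]] by simp
  fix i assume "i < length (stake n (boundary_act f \<eta>))"
  then have i: "i < n" by simp
  have "f (stake (Suc i) \<eta>) = take (Suc i) (f (stake n \<eta>))"
    using tree_aut_take[OF f stake_words[OF \<eta>, of n], of "Suc i"] i
    by (simp add: take_stake min_def del: stake.simps)
  then show "stake n (boundary_act f \<eta>) ! i = f (stake n \<eta>) ! i"
    using i by (simp add: boundary_act_def del: stake.simps)
qed

lemma stream_eqI_snth: "(\<And>n. \<eta> !! n = \<zeta> !! n) \<Longrightarrow> \<eta> = \<zeta>"
  by (metis ext stream_smap_nats)

lemma stream_eqI_stake: "(\<And>n. stake n \<eta> = stake n \<zeta>) \<Longrightarrow> \<eta> = \<zeta>"
  by (metis lessI stake_nth stream_eqI_snth)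

lemma boundary_act_closed:
  assumes f: "f \<in> carrier (tree_aut d)" and \<eta>: "\<eta> \<in> boundary d"
  shows "boundary_act f \<eta> \<in> boundary d"
proof -
  have "boundary_act f \<eta> !! n < d" for n
  proof -
    have "stake (Suc n) (boundary_act f \<eta>) \<in> words d"
      unfolding stake_boundary_act[OF f \<eta>]
      by (rule tree_aut_closed[OF f stake_words[OF \<eta>]])
    then have "stake (Suc n) (boundary_act f \<eta>) ! n \<in> {..<d}"
      unfolding words_def using nth_mem[of n "stake (Suc n) (boundary_act f \<eta>)"]
      by (auto simp del: stake.simps)
    then show ?thesis by (simp del: stake.simps)
  qed
  then show ?thesis unfolding boundary_def streams_iff_snth by simp
qed

lemma boundary_act_one:
  assumes "\<eta> \<in> boundary d"
  shows "boundary_act \<one>\<^bsub>tree_aut d\<^esub> \<eta> = \<eta>"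
proof (rule stream_eqI_stake)
  fix n
  interpret group "tree_aut d" by (rule group_tree_aut)
  show "stake n (boundary_act \<one>\<^bsub>tree_aut d\<^esub> \<eta>) = stake n \<eta>"
    using stake_boundary_act[OF one_closed assms] stake_words[OF assms]
    by (simp add: one_tree_aut)
qed

text \<open>With the product read as "first \<open>f\<close>, then \<open>g\<close>", the group acts
  from the left on infinite words.\<close>

lemma boundary_act_mult:
  assumes g: "g \<in> carrier (tree_aut d)" and f: "f \<in> carrier (tree_aut d)"
    and \<eta>: "\<eta> \<in> boundary d"
  shows "boundary_act (g \<otimes>\<^bsub>tree_aut d\<^esub> f) \<eta> = boundary_act g (boundary_act f \<eta>)"
proof (rule stream_eqI_stake)
  fix n
  interpret group "tree_aut d" by (rule group_tree_aut)
  show "stake n (boundary_act (g \<otimes>\<^bsub>tree_aut d\<^esub> f) \<eta>) = stake n (boundary_act g (boundary_act f \<eta>))"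
    using stake_boundary_act[OF m_closed[OF g f] \<eta>] stake_boundary_act[OF f \<eta>]
      stake_boundary_act[OF g boundary_act_closed[OF f \<eta>]] stake_words[OF \<eta>]
    by (simp add: mult_tree_aut[OF g f] compose_eq)
qed

section \<open>Adding to each letter a function of the preceding prefix\<close>

text \<open>In the language of portraits, \<open>\<delta> u\<close> is the exponent of the cyclic
  permutation attached to the vertex \<open>u\<close>. The vertex is a prefix of the argument, not
  of the image, and only the residue of \<open>\<delta> u\<close> modulo \<open>d\<close>
  matters.\<close>

definition shift_aut :: "nat \<Rightarrow> (nat list \<Rightarrow> nat) \<Rightarrow> nat list \<Rightarrow> nat list" where
  "shift_aut d \<delta> = (\<lambda>w\<in>words d. map (\<lambda>i. (w ! i + \<delta> (take i w)) mod d) [0..<length w])"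

lemma length_shift_aut [simp]: "w \<in> words d \<Longrightarrow> length (shift_aut d \<delta> w) = length w"
  by (simp add: shift_aut_def)

lemma nth_shift_aut:
  "w \<in> words d \<Longrightarrow> i < length w \<Longrightarrow> shift_aut d \<delta> w ! i = (w ! i + \<delta> (take i w)) mod d"
  by (simp add: shift_aut_def)

lemma shift_aut_words: "d > 0 \<Longrightarrow> w \<in> words d \<Longrightarrow> shift_aut d \<delta> w \<in> words d"
  by (auto simp: shift_aut_def words_def)

lemma take_shift_aut:
  "w \<in> words d \<Longrightarrow> take n (shift_aut d \<delta> w) = shift_aut d \<delta> (take n w)"
  by (rule nth_equalityI) (auto simp: nth_shift_aut words_take min_absorb1)

text \<open>Once the prefixes of length \<open>n\<close> agree, the same number is added to both
  letters at position \<open>n\<close>; it cancels modulo \<open>d\<close>, and letters are below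
  \<open>d\<close>.\<close>

lemma shift_aut_inj:
  assumes "d > 0"
  shows "inj_on (shift_aut d \<delta>) (words d)"
proof (rule inj_onI)
  fix u v assume u: "u \<in> words d" and v: "v \<in> words d" and eq: "shift_aut d \<delta> u = shift_aut d \<delta> v"
  have len: "length u = length v" using length_shift_aut[OF u] length_shift_aut[OF v] eq by metis
  have "n \<le> length u \<Longrightarrow> take n u = take n v" for n
  proof (induction n)
    case (Suc n)
    then have n: "n < length u" "n < length v" and IH: "take n u = take n v" using len by auto
    have "(u ! n + \<delta> (take n u)) mod d = (v ! n + \<delta> (take n u)) mod d"
      using nth_shift_aut[OF u n(1), of \<delta>] nth_shift_aut[OF v n(2), of \<delta>] eq IH by simp
    then have "[u ! n = v ! n] (mod d)" by (metis cong_add_rcancel_nat cong_def)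
    moreover have "u ! n < d" "v ! n < d" using u v n by (auto simp: words_def in_lists_conv_set)
    ultimately have "u ! n = v ! n" by (simp add: cong_def)
    then show ?case using IH n by (simp add: take_Suc_conv_app_nth)
  qed simp
  then show "u = v" using len by (metis order_refl take_all_iff)
qed

text \<open>Each level of the tree is finite and mapped into itself, so injectivity already gives
  surjectivity and no formula for the inverse is required.\<close>

lemma shift_aut_surj:
  assumes d: "d > 0"
  shows "shift_aut d \<delta> ` words d = words d"
proof
  show "shift_aut d \<delta> ` words d \<subseteq> words d" using shift_aut_words[OF d] by blast
  show "words d \<subseteq> shift_aut d \<delta> ` words d"
  proof
    fix w assume w: "w \<in> words d"
    define W where "W = {u. set u \<subseteq> {..<d} \<and> length u = length w}"
    have W: "u \<in> W \<longleftrightarrow> u \<in> words d \<and> length u = length w" for u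
      by (auto simp: W_def words_def in_lists_conv_set)
    have "shift_aut d \<delta> ` W = W"
    proof (rule endo_inj_surj)
      show "finite W" unfolding W_def by (rule finite_lists_length_eq) simp
      show "shift_aut d \<delta> ` W \<subseteq> W" using shift_aut_words[OF d] by (auto simp: W)
      show "inj_on (shift_aut d \<delta>) W" using shift_aut_inj[OF d] by (rule inj_on_subset) (auto simp: W)
    qed
    moreover have "w \<in> W" using w by (simp add: W)
    ultimately show "w \<in> shift_aut d \<delta> ` words d" using W by blast
  qed
qed

text \<open>Half of the preservation of adjacency; the other half arises by exchanging
  \<open>u\<close> and \<open>v\<close>. Both directions use that lengths and prefixes are
  respected, and recovering \<open>u\<close> from its image uses injectivity.\<close>

lemma shift_aut_snoc:
  assumes d: "d > 0" and u: "u \<in> words d" and v: "v \<in> words d"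
  shows "(\<exists>x. shift_aut d \<delta> v = shift_aut d \<delta> u @ [x]) \<longleftrightarrow> (\<exists>x. v = u @ [x])"
proof
  assume "\<exists>x. shift_aut d \<delta> v = shift_aut d \<delta> u @ [x]"
  then obtain x where x: "shift_aut d \<delta> v = shift_aut d \<delta> u @ [x]" ..
  have len: "length v = Suc (length u)"
    using arg_cong[OF x, of length] u v by simp
  have "shift_aut d \<delta> (take (length u) v) = shift_aut d \<delta> u"
    using take_shift_aut[OF v, of "length u" \<delta>] x u by simp
  then have "take (length u) v = u"
    using shift_aut_inj[OF d] words_take[OF v] u by (meson inj_onD)
  then show "\<exists>x. v = u @ [x]"
    using len by (metis lessI order_refl take_Suc_conv_app_nth take_all)
next
  assume "\<exists>x. v = u @ [x]"
  then obtain x where x: "v = u @ [x]" ..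
  have "take (length u) (shift_aut d \<delta> v) = shift_aut d \<delta> u"
    using take_shift_aut[OF v, of "length u" \<delta>] x by simp
  moreover have "length (shift_aut d \<delta> v) = Suc (length u)" using v x by simp
  ultimately show "\<exists>x. shift_aut d \<delta> v = shift_aut d \<delta> u @ [x]"
    by (metis lessI order_refl take_Suc_conv_app_nth take_all)
qed

lemma shift_aut_carrier:
  assumes d: "d > 0"
  shows "shift_aut d \<delta> \<in> carrier (tree_aut d)"
proof -
  have "shift_aut d \<delta> \<in> Bij (words d)"
    using shift_aut_inj[OF d] shift_aut_surj[OF d]
    by (auto simp: Bij_def bij_betw_def) (simp add: shift_aut_def)
  moreover have "shift_aut d \<delta> [] = []" by (simp add: shift_aut_def words_def)
  ultimately show ?thesis
    using shift_aut_snoc[OF d] by (simp add: tree_aut_carrier_iff tree_adj_def)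
qed

lemma shift_aut_eqI:
  assumes "\<And>u. u \<in> words d \<Longrightarrow> \<delta> u mod d = \<epsilon> u mod d"
  shows "shift_aut d \<delta> = shift_aut d \<epsilon>"
proof (rule ext)
  fix w
  show "shift_aut d \<delta> w = shift_aut d \<epsilon> w"
  proof (cases "w \<in> words d")
    case True
    then show ?thesis
      by (auto intro!: nth_equalityI mod_add_cong simp: nth_shift_aut assms words_take)
  qed (simp add: shift_aut_def)
qed

lemma one_eq_shift_aut: "\<one>\<^bsub>tree_aut d\<^esub> = shift_aut d (\<lambda>_. 0)"
  by (rule ext)
    (auto simp: one_tree_aut shift_aut_def restrict_def words_def in_lists_conv_set intro!: nth_equalityI)

lemma boundary_act_shift_aut_nth:
  assumes "\<eta> \<in> boundary d"
  shows "boundary_act (shift_aut d \<delta>) \<eta> !! n = (\<eta> !! n + \<delta> (stake n \<eta>)) mod d"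
  using stake_words[OF assms, of "Suc n"]
  by (simp add: boundary_act_def nth_shift_aut take_stake min_def del: stake.simps)

text \<open>A cocycle rule: the second factor to act, \<open>shift_aut d \<delta>\<close>, sees the
  prefix after the first one has moved it, hence the argument
  \<open>shift_aut d \<epsilon> u\<close> of \<open>\<delta>\<close>.\<close>

lemma shift_aut_mult:
  assumes d: "d > 0"
  shows "shift_aut d \<delta> \<otimes>\<^bsub>tree_aut d\<^esub> shift_aut d \<epsilon> =
    shift_aut d (\<lambda>u. \<epsilon> u + \<delta> (shift_aut d \<epsilon> u))"
proof (rule ext)
  fix w
  show "(shift_aut d \<delta> \<otimes>\<^bsub>tree_aut d\<^esub> shift_aut d \<epsilon>) w =
    shift_aut d (\<lambda>u. \<epsilon> u + \<delta> (shift_aut d \<epsilon> u)) w"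
  proof (cases "w \<in> words d")
    case True
    have "shift_aut d \<delta> (shift_aut d \<epsilon> w) = shift_aut d (\<lambda>u. \<epsilon> u + \<delta> (shift_aut d \<epsilon> u)) w"
    proof (rule nth_equalityI)
      fix i assume "i < length (shift_aut d \<delta> (shift_aut d \<epsilon> w))"
      then have "i < length w" using True shift_aut_words[OF d True] by simp
      then show "shift_aut d \<delta> (shift_aut d \<epsilon> w) ! i =
          shift_aut d (\<lambda>u. \<epsilon> u + \<delta> (shift_aut d \<epsilon> u)) w ! i"
        using True shift_aut_words[OF d True]
        by (simp add: nth_shift_aut take_shift_aut mod_add_left_eq add.assoc)
    qed (use True shift_aut_words[OF d True] in simp)
    then show ?thesis
      using True by (simp add: mult_tree_aut shift_aut_carrier[OF d] compose_eq)
  next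
    case False
    then show ?thesis
      by (simp add: mult_tree_aut shift_aut_carrier[OF d] compose_def) (simp add: shift_aut_def)
  qed
qed

section \<open>The cyclic group generated by the rotation\<close>

lemma rot_eq_shift_aut:
  assumes "d > 0"
  shows "rot d = shift_aut d (\<lambda>u. if u = [] then 1 else 0)"
proof (rule ext)
  fix w
  show "rot d w = shift_aut d (\<lambda>u. if u = [] then 1 else 0) w"
  proof (cases "w \<in> words d")
    case True
    show ?thesis
    proof (rule nth_equalityI)
      show "length (rot d w) = length (shift_aut d (\<lambda>u. if u = [] then 1 else 0) w)"
        using True by (simp add: rot_def split: list.split)
      fix i assume "i < length (rot d w)"
      then have i: "i < length w" using True by (simp add: rot_def split: list.splits)
      then have "w ! i < d" using True by (auto simp: words_def)
      then show "rot d w ! i = shift_aut d (\<lambda>u. if u = [] then 1 else 0) w ! i"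
        using True i by (cases w; cases i) (auto simp: rot_def nth_shift_aut)
    qed
  next
    case False
    then show ?thesis by (simp add: rot_def shift_aut_def)
  qed
qed

lemma rot_carrier: "d > 0 \<Longrightarrow> rot d \<in> carrier (tree_aut d)"
  by (simp add: rot_eq_shift_aut shift_aut_carrier)

lemma rot_pow_eq_shift_aut:
  assumes "d > 0"
  shows "rot d [^]\<^bsub>tree_aut d\<^esub> (j::nat) = shift_aut d (\<lambda>u. if u = [] then j else 0)"
proof (induction j)
  case 0
  interpret group "tree_aut d" by (rule group_tree_aut)
  show ?case by (simp add: one_eq_shift_aut)
next
  case (Suc j)
  interpret group "tree_aut d" by (rule group_tree_aut)
  \<comment> \<open>The moved prefix is empty exactly when the original one is, so in the product
    the exponents at the root simply add.\<close>
  have Nil: "shift_aut d \<epsilon> u = [] \<longleftrightarrow> u = []" if "u \<in> words d" for u \<epsilon>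
    using length_shift_aut[OF that] by (metis length_0_conv)
  have "rot d [^]\<^bsub>tree_aut d\<^esub> Suc j =
      shift_aut d (\<lambda>u. if u = [] then j else 0) \<otimes>\<^bsub>tree_aut d\<^esub> shift_aut d (\<lambda>u. if u = [] then 1 else 0)"
    by (simp only: nat_pow_Suc Suc rot_eq_shift_aut[OF assms, symmetric])
  also have "\<dots> = shift_aut d (\<lambda>u. if u = [] then Suc j else 0)"
    unfolding shift_aut_mult[OF assms] by (rule shift_aut_eqI) (simp add: Nil)
  finally show ?case .
qed

lemma rot_pow_singleton:
  "v < d \<Longrightarrow> (rot d [^]\<^bsub>tree_aut d\<^esub> (j::nat)) [v] = [(v + j) mod d]"
  by (simp add: rot_pow_eq_shift_aut shift_aut_def words_def)

lemma rot_pow_inj: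
  assumes "d > 0" "j < d" "k < d"
    and "rot d [^]\<^bsub>tree_aut d\<^esub> j = rot d [^]\<^bsub>tree_aut d\<^esub> k"
  shows "j = k"
proof -
  \<comment> \<open>Acting on the letter 0 recovers an exponent below \<open>d\<close>.\<close>
  have "[j] = (rot d [^]\<^bsub>tree_aut d\<^esub> j) [0]"
    using assms(1,2) by (simp add: rot_pow_singleton)
  also have "\<dots> = [k]"
    unfolding assms(4) using assms(1,3) by (simp add: rot_pow_singleton)
  finally show ?thesis by simp
qed

text \<open>The generated subgroup consists of the integer powers of \<open>rot d\<close>. As the
  \<open>d\<close>-th power is trivial, each exponent can be replaced by its residue, a natural
  number below \<open>d\<close>.\<close>

lemma carrier_A_grp:
  assumes d: "d > 0"
  shows "carrier (A_grp d) = (\<lambda>j. rot d [^]\<^bsub>tree_aut d\<^esub> j) ` {..<d}"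
proof -
  interpret group "tree_aut d" by (rule group_tree_aut)
  have "rot d [^]\<^bsub>tree_aut d\<^esub> d = \<one>\<^bsub>tree_aut d\<^esub>"
    unfolding rot_pow_eq_shift_aut[OF d] one_eq_shift_aut by (rule shift_aut_eqI) simp
  then have per: "rot d [^]\<^bsub>tree_aut d\<^esub> (int d) = \<one>\<^bsub>tree_aut d\<^esub>" by (simp add: int_pow_int)
  have red: "rot d [^]\<^bsub>tree_aut d\<^esub> n = rot d [^]\<^bsub>tree_aut d\<^esub> (nat (n mod int d))" for n :: int
  proof -
    have "rot d [^]\<^bsub>tree_aut d\<^esub> n = rot d [^]\<^bsub>tree_aut d\<^esub> (int d * (n div int d) + n mod int d)" by simp
    also have "\<dots> = rot d [^]\<^bsub>tree_aut d\<^esub> (n mod int d)"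
      unfolding int_pow_mult[OF rot_carrier[OF d]] int_pow_pow[OF rot_carrier[OF d], symmetric] per
      using rot_carrier[OF d] by simp
    also have "\<dots> = rot d [^]\<^bsub>tree_aut d\<^esub> (nat (n mod int d))"
      unfolding int_pow_int[symmetric] using d by simp
    finally show ?thesis .
  qed
  have "carrier (A_grp d) = range (\<lambda>n::int. rot d [^]\<^bsub>tree_aut d\<^esub> n)"
    unfolding A_grp_def by (rule carrier_subgroup_generated_by_singleton[OF rot_carrier[OF d]])
  also have "\<dots> = (\<lambda>j. rot d [^]\<^bsub>tree_aut d\<^esub> j) ` {..<d}"
  proof
    show "range (\<lambda>n::int. rot d [^]\<^bsub>tree_aut d\<^esub> n) \<subseteq> (\<lambda>j. rot d [^]\<^bsub>tree_aut d\<^esub> j) ` {..<d}"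
    proof (rule image_subsetI)
      fix n :: int
      have "nat (n mod int d) < d" using d by (simp add: nat_less_iff)
      then show "rot d [^]\<^bsub>tree_aut d\<^esub> n \<in> (\<lambda>j. rot d [^]\<^bsub>tree_aut d\<^esub> j) ` {..<d}"
        unfolding red[of n] by (intro imageI) simp
    qed
    show "(\<lambda>j. rot d [^]\<^bsub>tree_aut d\<^esub> j) ` {..<d} \<subseteq> range (\<lambda>n::int. rot d [^]\<^bsub>tree_aut d\<^esub> n)"
    proof (rule image_subsetI)
      fix j :: nat
      show "rot d [^]\<^bsub>tree_aut d\<^esub> j \<in> range (\<lambda>n::int. rot d [^]\<^bsub>tree_aut d\<^esub> n)"
        unfolding int_pow_int[symmetric] by (rule rangeI)
    qed
  qed
  finally show ?thesis .
qed

lemma boundary_act_rot_pow: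
  assumes d: "d > 0" and \<eta>: "\<eta> \<in> boundary d"
  shows "boundary_act (rot d [^]\<^bsub>tree_aut d\<^esub> (j::nat)) \<eta> = ((shd \<eta> + j) mod d) ## stl \<eta>"
proof (rule stream_eqI_snth)
  fix n
  have "\<eta> !! n < d" using \<eta> by (simp add: boundary_def streams_iff_snth)
  then show "boundary_act (rot d [^]\<^bsub>tree_aut d\<^esub> j) \<eta> !! n = (((shd \<eta> + j) mod d) ## stl \<eta>) !! n"
    unfolding rot_pow_eq_shift_aut[OF d] boundary_act_shift_aut_nth[OF \<eta>]
    by (cases n) simp_all
qed

section \<open>Directed automorphisms\<close>

text \<open>The portrait of a directed automorphism: labels sit only at the vertices branching off
  the ray of letters \<open>d - 1\<close> by a letter 0. For such a vertex
  \<open>length u - 1\<close> is the number \<open>r\<close> of letters before the 0; every other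
  vertex gets the trivial label 0.\<close>

definition spine :: "nat \<Rightarrow> (nat \<Rightarrow> nat) \<Rightarrow> nat list \<Rightarrow> nat" where
  "spine d c u = (if \<exists>r. u = replicate r (d - 1) @ [0] then c (length u - 1) else 0)"

text \<open>The first letter different from \<open>a\<close> marks the end of the block. This is the
  uniqueness of the decomposition in the description of directed automorphisms.\<close>

lemma replicate_Cons_eq_iff:
  assumes "a \<noteq> b"
  shows "replicate r a @ b # x = replicate s a @ b # y \<longleftrightarrow> r = s \<and> x = y"
proof (induction r arbitrary: s)
  case 0
  then show ?case using assms by (cases s) auto
next
  case (Suc r)
  then show ?case using assms by (cases s) auto
qed

lemma spine_replicate:
  assumes "d \<ge> 2"
  shows "spine d c (replicate n (d - 1)) = 0"
proof -
  have "replicate n (d - 1) \<noteq> replicate r (d - 1) @ [0]" for r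
  proof
    assume "replicate n (d - 1) = replicate r (d - 1) @ [0]"
    then have "0 \<in> set (replicate n (d - 1))" by simp
    then show False using assms by (simp split: if_splits)
  qed
  then show ?thesis by (simp add: spine_def)
qed

lemma spine_replicate_Cons:
  assumes "d \<ge> 2"
  shows "spine d c (replicate n (d - 1) @ 0 # x) = (if x = [] then c n else 0)"
  using replicate_Cons_eq_iff[of "d - 1" 0 n x _ "[]"] assms by (auto simp: spine_def)

text \<open>Since the decomposition is unique, the definite description in \<open>b_aut\<close> has
  exactly one candidate.\<close>

lemma b_aut_decomp:
  assumes "d \<ge> 2" and "replicate r (d - 1) @ 0 # v # u \<in> words d"
  shows "b_aut d \<omega> b (replicate r (d - 1) @ 0 # v # u) =
    replicate r (d - 1) @ 0 # hd (\<omega> r b [v]) # u"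
proof -
  have *: "replicate r (d - 1) @ 0 # v # u = replicate r' (d - 1) @ 0 # v' # u' \<longleftrightarrow>
      r = r' \<and> v = v' \<and> u = u'" for r' v' u'
    using replicate_Cons_eq_iff[of "d - 1" 0 r "v # u" r' "v' # u'"] assms(1) by auto
  have "(\<exists>r' v' u'. replicate r (d - 1) @ 0 # v # u = replicate r' (d - 1) @ 0 # v' # u') = True"
    by blast
  then show ?thesis using assms(2) unfolding b_aut_def by (simp only: * restrict_apply if_True) simp
qed

text \<open>Brings the directed generators under the general theory of \<open>shift_aut\<close>. In
  a decomposable word exactly one letter has a prefix at which \<open>spine\<close> may be nonzero,
  and it is the letter that \<open>b_aut\<close> changes; in any other word there is no such
  letter.\<close>

lemma b_aut_eq_shift_aut:
  assumes d: "d \<ge> 2" and c: "\<And>r. \<omega> r b = rot d [^]\<^bsub>tree_aut d\<^esub> c r"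
  shows "b_aut d \<omega> b = shift_aut d (spine d c)"
proof (rule ext)
  fix w
  consider (out) "w \<notin> words d"
    | (dec) r v u where "w \<in> words d" "w = replicate r (d - 1) @ 0 # v # u"
    | (none) "w \<in> words d" "\<nexists>r v u. w = replicate r (d - 1) @ 0 # v # u"
    by blast
  then show "b_aut d \<omega> b w = shift_aut d (spine d c) w"
  proof cases
    case out
    then show ?thesis by (simp add: b_aut_def shift_aut_def)
  next
    case dec
    then have "v < d" by (auto simp: words_def)
    have lt: "w ! i < d" if "i < length w" for i
      using nth_mem[OF that] dec(1) by (auto simp: words_def)
    from \<open>v < d\<close> have b: "b_aut d \<omega> b w = replicate r (d - 1) @ 0 # ((v + c r) mod d) # u"
      using b_aut_decomp[OF d] dec c rot_pow_singleton[of v d "c r"] by simp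
    show ?thesis
    proof (rule nth_equalityI)
      show "length (b_aut d \<omega> b w) = length (shift_aut d (spine d c) w)"
        unfolding b length_shift_aut[OF dec(1)] by (simp add: dec(2))
      fix i assume "i < length (b_aut d \<omega> b w)"
      then have i: "i < length w" unfolding b by (simp add: dec(2))
      \<comment> \<open>Up to and including the 0, the prefix before position \<open>i\<close> is a
        pure power of \<open>d - 1\<close>; at \<open>Suc r\<close> it is the labelled vertex;
        further on it properly extends that vertex, where \<open>spine\<close> vanishes
        again.\<close>
      consider "i \<le> r" | "i = Suc r" | k where "i = Suc (Suc (r + k))"
        by atomize_elim presburger
      then show "b_aut d \<omega> b w ! i = shift_aut d (spine d c) w ! i"
      proof cases
        case 1
        then have "take i w = replicate i (d - 1)" by (simp add: dec)
        then show ?thesis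
          using 1 i lt[OF i] dec(1) spine_replicate[OF d, of c i]
          by (simp add: nth_shift_aut b) (simp add: dec(2) nth_append)
      next
        case 2
        then have "take i w = replicate r (d - 1) @ 0 # []" by (simp add: dec)
        then show ?thesis
          using 2 i dec(1) spine_replicate_Cons[OF d, of c r "[]"]
          by (simp add: nth_shift_aut b) (simp add: dec(2) nth_append)
      next
        case 3
        then have "take i w = replicate r (d - 1) @ 0 # v # take k u" by (simp add: dec)
        then show ?thesis
          using 3 i lt[OF i] dec(1) spine_replicate_Cons[OF d, of c r "v # take k u"]
          by (simp add: nth_shift_aut b) (simp add: dec(2) nth_append)
      qed
    qed
  next
    case none
    then have "b_aut d \<omega> b w = w" by (simp add: b_aut_def)
    also have "w = shift_aut d (spine d c) w"
    proof (rule nth_equalityI)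
      fix i assume i: "i < length w"
      \<comment> \<open>A labelled vertex followed by the letter \<open>w ! i\<close> would be a
        decomposition of \<open>w\<close>. The word may still end exactly at a labelled vertex, as
        no letter follows there.\<close>
      have "take i w \<noteq> replicate r (d - 1) @ [0]" for r
      proof
        assume "take i w = replicate r (d - 1) @ [0]"
        then have "w = replicate r (d - 1) @ 0 # w ! i # drop (Suc i) w"
          using id_take_nth_drop[OF i] by simp
        then show False using none by blast
      qed
      moreover have "w ! i < d" using none i by (auto simp: words_def)
      ultimately show "w ! i = shift_aut d (spine d c) w ! i"
        using none(1) i by (simp add: nth_shift_aut spine_def)
    qed (simp add: none)
    finally show ?thesis .
  qed
qed

text \<open>The infinite counterpart, with the same three ranges of positions.\<close>

lemma boundary_act_spine:
  assumes d: "d \<ge> 2" and \<eta>: "replicate n (d - 1) @- 0 ## v ## \<zeta> \<in> boundary d"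
  shows "boundary_act (shift_aut d (spine d c)) (replicate n (d - 1) @- 0 ## v ## \<zeta>) =
    replicate n (d - 1) @- 0 ## ((v + c n) mod d) ## \<zeta>"
proof (rule stream_eqI_snth)
  fix i
  let ?\<eta> = "replicate n (d - 1) @- 0 ## v ## \<zeta>"
  have lt: "?\<eta> !! i < d" using \<eta> by (simp add: boundary_def streams_iff_snth)
  consider "i \<le> n" | "i = Suc n" | k where "i = Suc (Suc (n + k))"
    by atomize_elim presburger
  then show "boundary_act (shift_aut d (spine d c)) ?\<eta> !! i =
      (replicate n (d - 1) @- 0 ## ((v + c n) mod d) ## \<zeta>) !! i"
  proof cases
    case 1
    then have st: "stake i ?\<eta> = replicate i (d - 1)" by (simp add: stake_shift)
    show ?thesis
      using 1 lt st spine_replicate[OF d, of c i]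
      unfolding boundary_act_shift_aut_nth[OF \<eta>]
      by (simp add: shift_snth)
  next
    case 2
    then have st: "stake i ?\<eta> = replicate n (d - 1) @ 0 # []" by (simp add: stake_shift Suc_diff_le)
    show ?thesis
      using 2 st spine_replicate_Cons[OF d, of c n "[]"]
      unfolding boundary_act_shift_aut_nth[OF \<eta>]
      by (simp add: shift_snth Suc_diff_le)
  next
    case 3
    then have st: "stake i ?\<eta> = replicate n (d - 1) @ 0 # v # stake k \<zeta>"
      by (simp add: stake_shift Suc_diff_le)
    show ?thesis
      using 3 lt spine_replicate_Cons[OF d, of c n "v # stake k \<zeta>"]
      unfolding boundary_act_shift_aut_nth[OF \<eta>] st
      by (simp add: shift_snth snth_Stream Suc_diff_le del: snth.simps)
  qed
qed

text \<open>No prefix of such a word is a labelled vertex: either all letters are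
  \<open>d - 1\<close>, or the first letter that differs from \<open>d - 1\<close> is not 0.\<close>

lemma boundary_act_spine_fix:
  assumes \<eta>: "\<eta> \<in> boundary d" and no: "\<nexists>n \<zeta>. \<eta> = replicate n (d - 1) @- 0 ## \<zeta>"
  shows "boundary_act (shift_aut d (spine d c)) \<eta> = \<eta>"
proof (rule stream_eqI_snth)
  fix i
  have "stake i \<eta> \<noteq> replicate r (d - 1) @ [0]" for r
  proof
    assume "stake i \<eta> = replicate r (d - 1) @ [0]"
    then have "\<eta> = replicate r (d - 1) @- 0 ## sdrop i \<eta>"
      using stake_sdrop[of i \<eta>] by simp
    then show False using no by blast
  qed
  moreover have "\<eta> !! i < d" using \<eta> by (simp add: boundary_def streams_iff_snth)
  ultimately show "boundary_act (shift_aut d (spine d c)) \<eta> !! i = \<eta> !! i"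
    by (simp add: boundary_act_shift_aut_nth[OF \<eta>] spine_def)
qed

section \<open>Generators and orbits of spinal groups\<close>

lemma group_B_grp: "group (B_grp d m)"
  by (simp add: B_grp_def)

lemma Omega_surj:
  assumes "d > 0" and "\<omega> \<in> Omega d m" and "j < d"
  obtains b where "b \<in> carrier (B_grp d m)" "\<omega> n b = rot d [^]\<^bsub>tree_aut d\<^esub> j"
proof -
  have "rot d [^]\<^bsub>tree_aut d\<^esub> j \<in> carrier (A_grp d)"
    using assms(3) by (simp add: carrier_A_grp[OF assms(1)])
  also have "carrier (A_grp d) = \<omega> n ` carrier (B_grp d m)"
    using assms(2) by (simp add: Omega_def epi_def)
  finally obtain b where "b \<in> carrier (B_grp d m)" "rot d [^]\<^bsub>tree_aut d\<^esub> j = \<omega> n b"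
    by (rule imageE)
  then show ?thesis by (intro that[of b]) simp_all
qed

text \<open>The exponents for all levels are chosen at once; the resulting sequence supplies the
  labels of \<open>spine\<close>.\<close>

lemma Omega_exponents:
  assumes "d > 0" and "\<omega> \<in> Omega d m" and "b \<in> carrier (B_grp d m)"
  obtains c where "\<And>n. c n < d" "\<And>n. \<omega> n b = rot d [^]\<^bsub>tree_aut d\<^esub> (c n :: nat)"
proof -
  have "\<omega> n b \<in> carrier (A_grp d)" for n
    using assms(2,3) by (auto simp: Omega_def epi_def hom_def)
  then have "\<forall>n. \<exists>j. j < d \<and> \<omega> n b = rot d [^]\<^bsub>tree_aut d\<^esub> j"
    unfolding carrier_A_grp[OF assms(1)] by auto
  then obtain c where "\<forall>n. c n < d \<and> \<omega> n b = rot d [^]\<^bsub>tree_aut d\<^esub> (c n :: nat)"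
    by (rule exE[OF choice])
  then show ?thesis by (intro that[of c]) simp_all
qed

lemma b_aut_carrier:
  assumes "d \<ge> 2" and "\<omega> \<in> Omega d m" and "b \<in> carrier (B_grp d m)"
  shows "b_aut d \<omega> b \<in> carrier (tree_aut d)"
proof -
  have d: "d > 0" using assms by simp
  obtain c where "\<And>n. c n < d" and c: "\<And>n. \<omega> n b = rot d [^]\<^bsub>tree_aut d\<^esub> (c n :: nat)"
    by (rule Omega_exponents[OF d assms(2,3)]) (rule that)
  from c have "b_aut d \<omega> b = shift_aut d (spine d c)" by (rule b_aut_eq_shift_aut[OF assms(1)])
  then show ?thesis by (simp add: shift_aut_carrier[OF d])
qed

lemma boundary_act_b_aut:
  assumes d: "d \<ge> 2" and \<omega>: "\<omega> \<in> Omega d m" and b: "b \<in> carrier (B_grp d m)"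
    and \<eta>: "replicate n (d - 1) @- 0 ## v ## \<zeta> \<in> boundary d"
    and j: "\<omega> n b = rot d [^]\<^bsub>tree_aut d\<^esub> j"
  shows "boundary_act (b_aut d \<omega> b) (replicate n (d - 1) @- 0 ## v ## \<zeta>) =
    replicate n (d - 1) @- 0 ## ((v + j) mod d) ## \<zeta>"
proof -
  have d0: "d > 0" using d by simp
  obtain c where "\<And>k. c k < d" and c: "\<And>k. \<omega> k b = rot d [^]\<^bsub>tree_aut d\<^esub> (c k :: nat)"
    by (rule Omega_exponents[OF d0 \<omega> b]) (rule that)
  \<comment> \<open>The given \<open>j\<close> need not be below \<open>d\<close>, so it may differ
    from \<open>c n\<close>. Both name the same power of the rotation, and overwriting
    \<open>c\<close> at \<open>n\<close> puts \<open>j\<close> itself into the formula.\<close>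
  have "\<omega> k b = rot d [^]\<^bsub>tree_aut d\<^esub> ((c(n := j)) k)" for k
  proof (cases "k = n")
    case True
    then show ?thesis by (simp only: fun_upd_same j)
  next
    case False
    then show ?thesis by (simp only: fun_upd_apply if_False c)
  qed
  then have "b_aut d \<omega> b = shift_aut d (spine d (c(n := j)))" by (rule b_aut_eq_shift_aut[OF d])
  then show ?thesis using boundary_act_spine[OF d \<eta>, of "c(n := j)"] by simp
qed

lemma boundary_act_b_aut_fix:
  assumes d: "d \<ge> 2" and \<omega>: "\<omega> \<in> Omega d m" and b: "b \<in> carrier (B_grp d m)"
    and \<eta>: "\<eta> \<in> boundary d" and no: "\<nexists>n \<zeta>. \<eta> = replicate n (d - 1) @- 0 ## \<zeta>"
  shows "boundary_act (b_aut d \<omega> b) \<eta> = \<eta>"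
proof -
  have d0: "d > 0" using d by simp
  obtain c where "\<And>k. c k < d" and c: "\<And>k. \<omega> k b = rot d [^]\<^bsub>tree_aut d\<^esub> (c k :: nat)"
    by (rule Omega_exponents[OF d0 \<omega> b]) (rule that)
  have "b_aut d \<omega> b = shift_aut d (spine d c)" using c by (rule b_aut_eq_shift_aut[OF d])
  then show ?thesis by (simp add: boundary_act_spine_fix[OF \<eta> no])
qed

text \<open>If \<open>b_aut d \<omega> b\<close> is trivial, then so is each
  \<open>\<omega> n b\<close>, which places \<open>b\<close> in all the kernels. It follows that
  distinguishing nontrivial \<open>b\<close> from 1 can be done on labels of arcs.\<close>

lemma b_aut_eq_one_iff:
  assumes d: "d \<ge> 2" and \<omega>: "\<omega> \<in> Omega d m" and b: "b \<in> carrier (B_grp d m)"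
  shows "b_aut d \<omega> b = \<one>\<^bsub>tree_aut d\<^esub> \<longleftrightarrow> b = \<one>\<^bsub>B_grp d m\<^esub>"
proof
  interpret T: group "tree_aut d" by (rule group_tree_aut)
  have d0: "d > 0" using d by simp
  obtain c where lt: "\<And>n. c n < d" and c: "\<And>n. \<omega> n b = rot d [^]\<^bsub>tree_aut d\<^esub> (c n :: nat)"
    by (rule Omega_exponents[OF d0 \<omega> b]) (rule that)
  have A1: "\<one>\<^bsub>A_grp d\<^esub> = rot d [^]\<^bsub>tree_aut d\<^esub> (0::nat)" by (simp add: A_grp_def)
  {
    assume b1: "b = \<one>\<^bsub>B_grp d m\<^esub>"
    have "\<omega> n \<in> hom (B_grp d m) (A_grp d)" for n
      using \<omega> by (simp add: Omega_def epi_def)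
    moreover have "group (A_grp d)"
      unfolding A_grp_def by (rule T.group_subgroup_generated)
    ultimately have "\<omega> n b = rot d [^]\<^bsub>tree_aut d\<^esub> (0::nat)" for n
      unfolding b1 A1[symmetric] by (rule hom_one[OF _ group_B_grp])
    then have "b_aut d \<omega> b = shift_aut d (spine d (\<lambda>_. 0))"
      by (rule b_aut_eq_shift_aut[OF d])
    also have "\<dots> = \<one>\<^bsub>tree_aut d\<^esub>"
      unfolding one_eq_shift_aut by (rule shift_aut_eqI) (simp add: spine_def)
    finally show "b_aut d \<omega> b = \<one>\<^bsub>tree_aut d\<^esub>" .
  }
  assume one: "b_aut d \<omega> b = \<one>\<^bsub>tree_aut d\<^esub>"
  have "\<omega> n b = \<one>\<^bsub>A_grp d\<^esub>" for n
  proof -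
    \<comment> \<open>On this word the letter after the labelled vertex is 0, so its image is the
      exponent \<open>c n\<close> itself.\<close>
    let ?w = "replicate n (d - 1) @ 0 # 0 # []"
    have w: "?w \<in> words d" using d by (auto simp: words_def)
    have "b_aut d \<omega> b ?w = replicate n (d - 1) @ 0 # hd (\<omega> n b [0]) # []"
      by (rule b_aut_decomp[OF d w])
    then have "hd (\<omega> n b [0]) = 0" using one w by (simp add: one_tree_aut)
    then have "c n = 0" using c[of n] rot_pow_singleton[OF d0, of "c n"] lt[of n] by simp
    then show ?thesis using c[of n] A1 by simp
  qed
  then have "b \<in> (\<Inter>n\<in>{0..}. kernel (B_grp d m) (A_grp d) (\<omega> n))"
    using b by (intro INT_I) (simp add: kernel_def)
  also have "\<dots> = {\<one>\<^bsub>B_grp d m\<^esub>}"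
    \<comment> \<open>This is the instance \<open>i = 0\<close> of the kernel condition.\<close>
    using \<omega>[unfolded Omega_def mem_Collect_eq, THEN conjunct2] by (rule spec)
  finally show "b = \<one>\<^bsub>B_grp d m\<^esub>" by (rule singletonD)
qed

lemma image_minus_singleton:
  "(\<And>x. x \<in> X \<Longrightarrow> f x = y \<longleftrightarrow> x = z) \<Longrightarrow> f ` X - {y} = f ` (X - {z})"
  by auto

text \<open>Among the powers with exponent below \<open>d\<close> only exponent 0 gives the
  identity, and among the directed automorphisms only \<open>b = 1\<close>. Discarding the identity
  from the generators therefore discards just these two indices.\<close>

lemma spinal_gens_eq:
  assumes d: "d \<ge> 2" and \<omega>: "\<omega> \<in> Omega d m"
  shows "spinal_gens d m \<omega> =
    {rot d [^]\<^bsub>tree_aut d\<^esub> j | j. j \<in> {..<d} - {0}} \<union>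
    {b_aut d \<omega> b | b. b \<in> carrier (B_grp d m) - {\<one>\<^bsub>B_grp d m\<^esub>}}"
proof -
  interpret T: group "tree_aut d" by (rule group_tree_aut)
  have d0: "d > 0" using d by simp
  have "(\<lambda>j. rot d [^]\<^bsub>tree_aut d\<^esub> j) ` {..<d} - {\<one>\<^bsub>tree_aut d\<^esub>} =
      (\<lambda>j. rot d [^]\<^bsub>tree_aut d\<^esub> j) ` ({..<d} - {0})"
  proof (rule image_minus_singleton)
    fix j assume "j \<in> {..<d}"
    then show "rot d [^]\<^bsub>tree_aut d\<^esub> j = \<one>\<^bsub>tree_aut d\<^esub> \<longleftrightarrow> j = 0"
      using rot_pow_inj[OF d0 _ d0, of j] by auto
  qed
  moreover have "b_aut d \<omega> ` carrier (B_grp d m) - {\<one>\<^bsub>tree_aut d\<^esub>} =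
      b_aut d \<omega> ` (carrier (B_grp d m) - {\<one>\<^bsub>B_grp d m\<^esub>})"
    by (rule image_minus_singleton) (rule b_aut_eq_one_iff[OF d \<omega>])
  ultimately show ?thesis
    unfolding spinal_gens_def carrier_A_grp[OF d0] B_img_def Un_Diff by (simp only: Setcompr_eq_image)
qed

section \<open>Orbits and cofinality classes\<close>

lemma Cof_refl: "\<xi> \<in> boundary d \<Longrightarrow> \<xi> \<in> Cof d \<xi>"
  by (auto simp: Cof_def)

lemma Cof_sym: "\<xi> \<in> boundary d \<Longrightarrow> \<eta> \<in> Cof d \<xi> \<Longrightarrow> \<xi> \<in> Cof d \<eta>"
  by (auto simp: Cof_def dest: sym)

lemma Cof_trans:
  assumes "\<eta> \<in> Cof d \<xi>" and "\<zeta> \<in> Cof d \<eta>"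
  shows "\<zeta> \<in> Cof d \<xi>"
proof -
  obtain r s where "sdrop r \<xi> = sdrop r \<eta>" "sdrop s \<eta> = sdrop s \<zeta>" "\<zeta> \<in> boundary d"
    using assms by (auto simp: Cof_def)
  then have "sdrop (r + s) \<xi> = sdrop (r + s) \<zeta>" by (metis add.commute sdrop_add)
  then show ?thesis using \<open>\<zeta> \<in> boundary d\<close> by (auto simp: Cof_def)
qed

text \<open>\<open>subgroup_generated\<close> intersects its generating set with the carrier; by
  this inclusion no generator is lost.\<close>

lemma spinal_generators_carrier:
  assumes "d \<ge> 2" and "\<omega> \<in> Omega d m"
  shows "carrier (A_grp d) \<union> B_img d m \<omega> \<subseteq> carrier (tree_aut d)"
proof -
  interpret T: group "tree_aut d" by (rule group_tree_aut)
  show ?thesis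
    using b_aut_carrier[OF assms] assms(1)
    by (auto simp: B_img_def carrier_A_grp intro!: T.nat_pow_closed rot_carrier)
qed

lemma group_spinal_group: "group (spinal_group d m \<omega>)"
  unfolding spinal_group_def by (rule group.group_subgroup_generated[OF group_tree_aut])

lemma spinal_group_subset: "carrier (spinal_group d m \<omega>) \<subseteq> carrier (tree_aut d)"
  unfolding spinal_group_def by (rule group.carrier_subgroup_generated_subset[OF group_tree_aut])

lemma generators_in_spinal_group:
  assumes "d \<ge> 2" and "\<omega> \<in> Omega d m"
  shows "carrier (A_grp d) \<union> B_img d m \<omega> \<subseteq> carrier (spinal_group d m \<omega>)"
  unfolding spinal_group_def
  by (rule group.subgroup_generated_subset_carrier_subset[OF group_tree_aut spinal_generators_carrier[OF assms]])

text \<open>A rotation leaves the tail from position 1 alone, and a directed generator leaves the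
  tail from position \<open>n + 2\<close> alone or fixes the word.\<close>

lemma boundary_act_generator_Cof:
  assumes d: "d \<ge> 2" and \<omega>: "\<omega> \<in> Omega d m"
    and h: "h \<in> carrier (A_grp d) \<union> B_img d m \<omega>" and \<eta>: "\<eta> \<in> boundary d"
  shows "boundary_act h \<eta> \<in> Cof d \<eta>"
proof -
  have d0: "d > 0" using d by simp
  have "h \<in> carrier (tree_aut d)" using spinal_generators_carrier[OF d \<omega>] h by blast
  then have bd: "boundary_act h \<eta> \<in> boundary d" using \<eta> by (rule boundary_act_closed)
  have "\<exists>r. sdrop r \<eta> = sdrop r (boundary_act h \<eta>)"
  proof (cases "h \<in> carrier (A_grp d)")
    case True
    then obtain j :: nat where "h = rot d [^]\<^bsub>tree_aut d\<^esub> j" by (auto simp: carrier_A_grp[OF d0])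
    then have "sdrop 1 \<eta> = sdrop 1 (boundary_act h \<eta>)"
      using boundary_act_rot_pow[OF d0 \<eta>] by simp
    then show ?thesis ..
  next
    case False
    then obtain b where b: "b \<in> carrier (B_grp d m)" and hb: "h = b_aut d \<omega> b"
      using h by (auto simp: B_img_def)
    show ?thesis
    proof (cases "\<exists>n \<zeta>. \<eta> = replicate n (d - 1) @- 0 ## \<zeta>")
      case True
      then obtain n v \<zeta> where eq: "\<eta> = replicate n (d - 1) @- 0 ## v ## \<zeta>"
        by (metis stream.collapse)
      obtain c where "\<And>k. c k < d" and c: "\<And>k. \<omega> k b = rot d [^]\<^bsub>tree_aut d\<^esub> (c k :: nat)"
        by (rule Omega_exponents[OF d0 \<omega> b]) (rule that)
      have "boundary_act h \<eta> = replicate n (d - 1) @- 0 ## ((v + c n) mod d) ## \<zeta>"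
        unfolding hb eq by (rule boundary_act_b_aut[OF d \<omega> b \<eta>[unfolded eq] c])
      then have "sdrop (n + 2) \<eta> = sdrop (n + 2) (boundary_act h \<eta>)"
        by (simp add: eq sdrop_shift numeral_2_eq_2)
      then show ?thesis ..
    next
      case False
      then show ?thesis using boundary_act_b_aut_fix[OF d \<omega> b \<eta>] hb by metis
    qed
  qed
  then show ?thesis using bd by (simp add: Cof_def)
qed

lemma boundary_act_spinal_group_Cof:
  assumes d: "d \<ge> 2" and \<omega>: "\<omega> \<in> Omega d m" and g: "g \<in> carrier (spinal_group d m \<omega>)"
  shows "\<eta> \<in> boundary d \<Longrightarrow> boundary_act g \<eta> \<in> Cof d \<eta>"
proof -
  interpret T: group "tree_aut d" by (rule group_tree_aut)
  let ?S = "carrier (tree_aut d) \<inter> (carrier (A_grp d) \<union> B_img d m \<omega>)"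
  have "g \<in> generate (tree_aut d) ?S"
    using g by (simp add: spinal_group_def carrier_subgroup_generated)
  \<comment> \<open>The quantifier over all infinite words is inside the induction because, in a
    product, the left factor acts at the moved word \<open>boundary_act h \<eta>\<close>.\<close>
  then have "\<forall>\<eta>\<in>boundary d. boundary_act g \<eta> \<in> Cof d \<eta>"
  proof (induction rule: generate.induct)
    case one
    then show ?case by (simp add: boundary_act_one Cof_refl)
  next
    case (incl h)
    then show ?case using boundary_act_generator_Cof[OF d \<omega>] by blast
  next
    case (inv h)
    then have h: "h \<in> carrier (tree_aut d)" and hS: "h \<in> carrier (A_grp d) \<union> B_img d m \<omega>" by auto
    show ?case
    proof
      fix \<eta> assume \<eta>: "\<eta> \<in> boundary d"
      let ?\<zeta> = "boundary_act (inv\<^bsub>tree_aut d\<^esub> h) \<eta>"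
      have \<zeta>: "?\<zeta> \<in> boundary d" using boundary_act_closed[OF T.inv_closed[OF h] \<eta>] .
      \<comment> \<open>The generator \<open>h\<close> carries \<open>?\<zeta>\<close> back to
        \<open>\<eta>\<close>, so the inverse is handled by the bound for \<open>h\<close> at
        \<open>?\<zeta>\<close> and the symmetry of cofinality.\<close>
      have "boundary_act h ?\<zeta> = \<eta>"
        using boundary_act_mult[OF h T.inv_closed[OF h] \<eta>] h \<eta> by (simp add: boundary_act_one)
      then show "?\<zeta> \<in> Cof d \<eta>"
        using boundary_act_generator_Cof[OF d \<omega> hS \<zeta>] Cof_sym[OF \<zeta>] by metis
    qed
  next
    case (eng g h)
    have gh: "g \<in> carrier (tree_aut d)" "h \<in> carrier (tree_aut d)"
      using eng.hyps T.generate_in_carrier by (meson Int_lower1)+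
    show ?case
    proof
      fix \<eta> assume \<eta>: "\<eta> \<in> boundary d"
      then show "boundary_act (g \<otimes>\<^bsub>tree_aut d\<^esub> h) \<eta> \<in> Cof d \<eta>"
        using boundary_act_mult[OF gh \<eta>] boundary_act_closed[OF gh(2) \<eta>] eng.IH Cof_trans by metis
    qed
  qed
  then show "\<eta> \<in> boundary d \<Longrightarrow> boundary_act g \<eta> \<in> Cof d \<eta>" by blast
qed

lemma spinal_orbit_trans:
  assumes \<xi>: "\<xi> \<in> boundary d"
    and "\<eta> \<in> orbit (spinal_group d m \<omega>) boundary_act \<xi>"
    and "\<zeta> \<in> orbit (spinal_group d m \<omega>) boundary_act \<eta>"
  shows "\<zeta> \<in> orbit (spinal_group d m \<omega>) boundary_act \<xi>"
proof -
  interpret G: group "spinal_group d m \<omega>" by (rule group_spinal_group)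
  obtain f g where f: "f \<in> carrier (spinal_group d m \<omega>)" "\<eta> = boundary_act f \<xi>"
    and g: "g \<in> carrier (spinal_group d m \<omega>)" "\<zeta> = boundary_act g \<eta>"
    using assms(2,3) by (auto simp: orbit_def)
  have "\<zeta> = boundary_act (g \<otimes>\<^bsub>spinal_group d m \<omega>\<^esub> f) \<xi>"
    using boundary_act_mult[of g d f \<xi>] f g \<xi> spinal_group_subset[of d m \<omega>]
    by (simp add: spinal_group_def subset_iff)
  then show ?thesis using G.m_closed[OF g(1) f(1)] by (auto simp: orbit_def)
qed

lemma generator_orbit:
  assumes "d \<ge> 2" and "\<omega> \<in> Omega d m" and "h \<in> carrier (A_grp d) \<union> B_img d m \<omega>"
  shows "boundary_act h \<eta> \<in> orbit (spinal_group d m \<omega>) boundary_act \<eta>"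
  using generators_in_spinal_group[OF assms(1,2)] assms(3) by (auto simp: orbit_def)

lemma shift_boundary:
  "w \<in> words d \<Longrightarrow> \<zeta> \<in> boundary d \<Longrightarrow> w @- \<zeta> \<in> boundary d"
  by (simp add: words_def boundary_def shift_streams)

text \<open>Rotations change the first letter. To change the last letter of a longer prefix, first turn
  the letters before it into \<open>(d - 1)\<^sup>n 0\<close>; then some \<open>b\<close> rotates it as required since \<open>\<omega> n\<close> is onto.\<close>

lemma spinal_orbit_prefix:
  assumes d: "d \<ge> 2" and \<omega>: "\<omega> \<in> Omega d m"
  shows "w \<in> words d \<Longrightarrow> w' \<in> words d \<Longrightarrow> length w = k \<Longrightarrow> length w' = k \<Longrightarrow> \<zeta> \<in> boundary d \<Longrightarrow>
    w' @- \<zeta> \<in> orbit (spinal_group d m \<omega>) boundary_act (w @- \<zeta>)"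
\<comment> \<open>The tail is generalized so that the induction hypothesis can act on the first
  \<open>k\<close> letters with the last letter moved into the tail.\<close>
proof (induction k arbitrary: w w' \<zeta>)
  case 0
  interpret G: group "spinal_group d m \<omega>" by (rule group_spinal_group)
  have "boundary_act \<one>\<^bsub>spinal_group d m \<omega>\<^esub> \<zeta> = \<zeta>"
    using boundary_act_one[OF 0(5)] by (simp add: spinal_group_def)
  then show ?case using 0 G.one_closed by (force simp: orbit_def)
next
  case (Suc k)
  let ?O = "orbit (spinal_group d m \<omega>) boundary_act"
  have d0: "d > 0" using d by simp
  obtain u v where w: "w = u @ [v]" and u: "length u = k"
    using Suc.prems(3) by (metis length_Suc_conv_rev)
  obtain u' v' where w': "w' = u' @ [v']" and u': "length u' = k"
    using Suc.prems(4) by (metis length_Suc_conv_rev)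
  have uw: "u \<in> words d" "v < d" "u' \<in> words d" "v' < d"
    using Suc.prems(1,2) by (auto simp: words_def w w')
  \<comment> \<open>Adding \<open>d\<close> first keeps the subtraction of natural numbers from
    being truncated.\<close>
  define j where "j = (v' + d - v) mod d"
  have jd: "j < d" using d0 by (simp add: j_def)
  have "(v + j) mod d = (v + (v' + d - v)) mod d" by (simp add: j_def mod_add_right_eq)
  then have vj: "(v + j) mod d = v'" using uw by simp
  have bd: "v ## \<zeta> \<in> boundary d" "v' ## \<zeta> \<in> boundary d"
    using uw Suc.prems(5) by (auto simp: boundary_def)
  have step: "u @- v' ## \<zeta> \<in> ?O (u @- v ## \<zeta>)"
  proof (cases k)
    case 0
    have "boundary_act (rot d [^]\<^bsub>tree_aut d\<^esub> j) (v ## \<zeta>) = v' ## \<zeta>"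
      using boundary_act_rot_pow[OF d0 bd(1), of j] vj by simp
    moreover have "rot d [^]\<^bsub>tree_aut d\<^esub> j \<in> carrier (A_grp d)"
      using jd by (simp add: carrier_A_grp[OF d0])
    ultimately show ?thesis
      using generator_orbit[OF d \<omega>, of "rot d [^]\<^bsub>tree_aut d\<^esub> j" "v ## \<zeta>"] u 0 by simp
  next
    case (Suc n)
    let ?p = "replicate n (d - 1) @ [0]"
    have p: "?p \<in> words d" "length ?p = k" using d Suc by (auto simp: words_def)
    obtain b where b: "b \<in> carrier (B_grp d m)" "\<omega> n b = rot d [^]\<^bsub>tree_aut d\<^esub> j"
      using Omega_surj[OF d0 \<omega> jd] .
    have "boundary_act (b_aut d \<omega> b) (?p @- v ## \<zeta>) = ?p @- v' ## \<zeta>"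
      using boundary_act_b_aut[OF d \<omega> b(1) _ b(2), of v \<zeta>] shift_boundary[OF p(1) bd(1)] vj by simp
    moreover have "b_aut d \<omega> b \<in> B_img d m \<omega>" using b by (simp add: B_img_def)
    ultimately have "?p @- v' ## \<zeta> \<in> ?O (?p @- v ## \<zeta>)"
      using generator_orbit[OF d \<omega>] by (metis UnCI)
    \<comment> \<open>The path is \<open>u\<close> to \<open>?p\<close>, then \<open>v\<close> to
      \<open>v'\<close> by the generator, then \<open>?p\<close> back to \<open>u\<close>; the outer
      legs are induction hypotheses with tails \<open>v ## \<zeta>\<close> and
      \<open>v' ## \<zeta>\<close>.\<close>
    then have "?p @- v' ## \<zeta> \<in> ?O (u @- v ## \<zeta>)"
      using spinal_orbit_trans[OF shift_boundary[OF uw(1) bd(1)]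
        Suc.IH[OF uw(1) p(1) u p(2) bd(1)]] by blast
    then show ?thesis
      using spinal_orbit_trans[OF shift_boundary[OF uw(1) bd(1)]]
        Suc.IH[OF p(1) uw(1) p(2) u bd(2)] by blast
  qed
  then have "u' @- v' ## \<zeta> \<in> ?O (u @- v ## \<zeta>)"
    using spinal_orbit_trans[OF shift_boundary[OF uw(1) bd(1)]]
      Suc.IH[OF uw(1,3) u u' bd(2)] by blast
  then show ?case by (simp add: w w')
qed

text \<open>For the inclusion from right to left, cofinal words share a tail after \<open>r\<close>
  letters and thus differ by an exchange of prefixes of length \<open>r\<close>.\<close>

lemma spinal_orbit_eq_Cof:
  assumes d: "d \<ge> 2" and \<omega>: "\<omega> \<in> Omega d m" and \<xi>: "\<xi> \<in> boundary d"
  shows "orbit (spinal_group d m \<omega>) boundary_act \<xi> = Cof d \<xi>"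
proof
  show "orbit (spinal_group d m \<omega>) boundary_act \<xi> \<subseteq> Cof d \<xi>"
    using boundary_act_spinal_group_Cof[OF d \<omega> _ \<xi>] by (auto simp: orbit_def)
  show "Cof d \<xi> \<subseteq> orbit (spinal_group d m \<omega>) boundary_act \<xi>"
  proof
    fix \<eta> assume "\<eta> \<in> Cof d \<xi>"
    then obtain r where \<eta>: "\<eta> \<in> boundary d" and r: "sdrop r \<xi> = sdrop r \<eta>" by (auto simp: Cof_def)
    have "sdrop r \<xi> \<in> boundary d" using \<xi> by (simp add: boundary_def streams_iff_snth sdrop_snth)
    then have "stake r \<eta> @- sdrop r \<xi> \<in> orbit (spinal_group d m \<omega>) boundary_act (stake r \<xi> @- sdrop r \<xi>)"
      using spinal_orbit_prefix[OF d \<omega> stake_words[OF \<xi>] stake_words[OF \<eta>]] by simp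
    then show "\<eta> \<in> orbit (spinal_group d m \<omega>) boundary_act \<xi>"
      using stake_sdrop[of r \<xi>] stake_sdrop[of r \<eta>] r by simp
  qed
qed

section \<open>Outgoing arcs of the Schreier graph\<close>

lemma out_arcs_schreier_graph:
  assumes "y \<in> orbit G \<phi> x"
  shows "out_arcs (schreier_graph G S \<phi> x) y = (\<lambda>s. (y, s, \<phi> s y)) ` S"
  using assms by (auto simp: out_arcs_def schreier_graph_def)

theorem proposition4p2:
  fixes d m :: nat
    and \<omega> :: "nat \<Rightarrow> (nat \<Rightarrow> int) \<Rightarrow> (nat list \<Rightarrow> nat list)"
    and \<xi> :: "nat stream"
  assumes "d \<ge> 2" and "m \<ge> 1" and "\<omega> \<in> Omega d m" and "\<xi> \<in> boundary d"
  shows "verts (spinal_schreier d m \<omega> \<xi>) = Cof d \<xi> \<and>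
    (\<forall>\<eta> \<in> Cof d \<xi>. out_arcs (spinal_schreier d m \<omega> \<xi>) \<eta> =
        {(\<eta>, rot d [^]\<^bsub>tree_aut d\<^esub> j, ((shd \<eta> + j) mod d) ## stl \<eta>) | j. j \<in> {..<d} - {0}}
      \<union> {(\<eta>, b_aut d \<omega> b, replicate n (d - 1) @- 0 ## ((\<eta> !! (n + 1) + j) mod d) ## sdrop (n + 2) \<eta>) | b n j.
           b \<in> carrier (B_grp d m) - {\<one>\<^bsub>B_grp d m\<^esub>} \<and>
           \<eta> = replicate n (d - 1) @- 0 ## \<eta> !! (n + 1) ## sdrop (n + 2) \<eta> \<and>
           j \<in> {..<d} \<and> \<omega> n b = rot d [^]\<^bsub>tree_aut d\<^esub> j}
      \<union> {(\<eta>, b_aut d \<omega> b, \<eta>) | b.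
           b \<in> carrier (B_grp d m) - {\<one>\<^bsub>B_grp d m\<^esub>} \<and>
           \<not> (\<exists>n. \<eta> = replicate n (d - 1) @- 0 ## \<eta> !! (n + 1) ## sdrop (n + 2) \<eta>)})"
proof
  show "verts (spinal_schreier d m \<omega> \<xi>) = Cof d \<xi>"
    using spinal_orbit_eq_Cof[OF assms(1,3,4)]
    by (simp add: spinal_schreier_def schreier_graph_def)
  show "\<forall>\<eta> \<in> Cof d \<xi>. out_arcs (spinal_schreier d m \<omega> \<xi>) \<eta> =
        {(\<eta>, rot d [^]\<^bsub>tree_aut d\<^esub> j, ((shd \<eta> + j) mod d) ## stl \<eta>) | j. j \<in> {..<d} - {0}}
      \<union> {(\<eta>, b_aut d \<omega> b, replicate n (d - 1) @- 0 ## ((\<eta> !! (n + 1) + j) mod d) ## sdrop (n + 2) \<eta>) | b n j.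
           b \<in> carrier (B_grp d m) - {\<one>\<^bsub>B_grp d m\<^esub>} \<and>
           \<eta> = replicate n (d - 1) @- 0 ## \<eta> !! (n + 1) ## sdrop (n + 2) \<eta> \<and>
           j \<in> {..<d} \<and> \<omega> n b = rot d [^]\<^bsub>tree_aut d\<^esub> j}
      \<union> {(\<eta>, b_aut d \<omega> b, \<eta>) | b.
           b \<in> carrier (B_grp d m) - {\<one>\<^bsub>B_grp d m\<^esub>} \<and>
           \<not> (\<exists>n. \<eta> = replicate n (d - 1) @- 0 ## \<eta> !! (n + 1) ## sdrop (n + 2) \<eta>)}"
    (is "\<forall>\<eta> \<in> _. _ = ?A \<eta> \<union> ?B \<eta> \<union> ?C \<eta>")
  proof
    fix \<eta> assume \<eta>C: "\<eta> \<in> Cof d \<xi>"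
    let ?dec = "\<lambda>n. \<eta> = replicate n (d - 1) @- 0 ## \<eta> !! (n + 1) ## sdrop (n + 2) \<eta>"
    let ?B1 = "carrier (B_grp d m) - {\<one>\<^bsub>B_grp d m\<^esub>}"
    have d0: "d > 0" using assms(1) by simp
    have \<eta>: "\<eta> \<in> boundary d" using \<eta>C by (simp add: Cof_def)
    have A: "boundary_act (rot d [^]\<^bsub>tree_aut d\<^esub> j) \<eta> = ((shd \<eta> + j) mod d) ## stl \<eta>" for j :: nat
      by (rule boundary_act_rot_pow[OF d0 \<eta>])
    have B: "boundary_act (b_aut d \<omega> b) \<eta> =
        replicate n (d - 1) @- 0 ## ((\<eta> !! (n + 1) + j) mod d) ## sdrop (n + 2) \<eta>"
      if "b \<in> carrier (B_grp d m)" "?dec n" "\<omega> n b = rot d [^]\<^bsub>tree_aut d\<^esub> j" for b n and j :: nat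
      using boundary_act_b_aut[OF assms(1,3) that(1) _ that(3)] \<eta> that(2) by metis
    \<comment> \<open>Any splitting off of \<open>(d - 1)^n 0\<close> determines the letter and the
      tail after it. So \<open>?dec n\<close> says just that the word starts in this way, and its
      failure for all \<open>n\<close> is the hypothesis of the fixed point lemma.\<close>
    have dec: "?dec n" if "\<eta> = replicate n (d - 1) @- 0 ## \<zeta>" for n \<zeta>
    proof -
      have n: "sdrop n \<eta> = 0 ## \<zeta>" using that by (simp add: sdrop_shift)
      have "\<eta> !! (n + 1) = shd \<zeta>" using sdrop_snth[of n \<eta> 1] n by simp
      moreover have "sdrop (n + 2) \<eta> = stl \<zeta>"
        using sdrop_add[of 2 n \<eta>] n by (simp add: numeral_2_eq_2)
      ultimately show ?thesis using that by simp
    qed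
    have C: "boundary_act (b_aut d \<omega> b) \<eta> = \<eta>"
      if "b \<in> carrier (B_grp d m)" "\<nexists>n. ?dec n" for b
      using boundary_act_b_aut_fix[OF assms(1,3) that(1) \<eta>] that(2) dec by blast
    have "out_arcs (spinal_schreier d m \<omega> \<xi>) \<eta> = (\<lambda>s. (\<eta>, s, boundary_act s \<eta>)) ` spinal_gens d m \<omega>"
      unfolding spinal_schreier_def
      by (rule out_arcs_schreier_graph) (simp add: spinal_orbit_eq_Cof[OF assms(1,3,4)] \<eta>C)
    also have "\<dots> = {(\<eta>, rot d [^]\<^bsub>tree_aut d\<^esub> j, boundary_act (rot d [^]\<^bsub>tree_aut d\<^esub> j) \<eta>) | j. j \<in> {..<d} - {0}}
        \<union> {(\<eta>, b_aut d \<omega> b, boundary_act (b_aut d \<omega> b) \<eta>) | b. b \<in> ?B1}"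
      unfolding spinal_gens_eq[OF assms(1,3)] by blast
    also have "{(\<eta>, rot d [^]\<^bsub>tree_aut d\<^esub> j, boundary_act (rot d [^]\<^bsub>tree_aut d\<^esub> j) \<eta>) | j. j \<in> {..<d} - {0}} = ?A \<eta>"
      by (simp add: A)
    also have "{(\<eta>, b_aut d \<omega> b, boundary_act (b_aut d \<omega> b) \<eta>) | b. b \<in> ?B1} = ?B \<eta> \<union> ?C \<eta>"
    proof
      \<comment> \<open>Whichever \<open>n\<close> and \<open>j\<close> satisfy the conditions,
        \<open>B\<close> identifies the target with the true image, so the extra quantifiers create
        no further arcs.\<close>
      show "?B \<eta> \<union> ?C \<eta> \<subseteq> {(\<eta>, b_aut d \<omega> b, boundary_act (b_aut d \<omega> b) \<eta>) | b. b \<in> ?B1}"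
        using B C by fastforce
      show "{(\<eta>, b_aut d \<omega> b, boundary_act (b_aut d \<omega> b) \<eta>) | b. b \<in> ?B1} \<subseteq> ?B \<eta> \<union> ?C \<eta>"
      proof (rule subsetI)
        fix e assume "e \<in> {(\<eta>, b_aut d \<omega> b, boundary_act (b_aut d \<omega> b) \<eta>) | b. b \<in> ?B1}"
        then obtain b where b: "b \<in> ?B1" and e: "e = (\<eta>, b_aut d \<omega> b, boundary_act (b_aut d \<omega> b) \<eta>)"
          by blast
        have bc: "b \<in> carrier (B_grp d m)" using b by simp
        show "e \<in> ?B \<eta> \<union> ?C \<eta>"
        proof (cases "\<exists>n. ?dec n")
          case True
          then obtain n where n: "?dec n" ..
          \<comment> \<open>The exponent \<open>c n\<close> is the required \<open>j\<close>; its
            bound is \<open>lt\<close>.\<close>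
          obtain c where lt: "\<And>k. c k < d" and c: "\<And>k. \<omega> k b = rot d [^]\<^bsub>tree_aut d\<^esub> (c k :: nat)"
            by (rule Omega_exponents[OF d0 assms(3) bc]) (rule that)
          have "e \<in> ?B \<eta>"
            unfolding e B[OF bc n c] using b n c[of n] lt[of n] by blast
          then show ?thesis ..
        next
          case False
          then have "e \<in> ?C \<eta>" unfolding e C[OF bc False] using b by blast
          then show ?thesis ..
        qed
      qed
    qed
    finally show "out_arcs (spinal_schreier d m \<omega> \<xi>) \<eta> = ?A \<eta> \<union> ?B \<eta> \<union> ?C \<eta>"
      by (simp only: Un_assoc)
  qed
qed

end
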